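(* Let $(X_1,Y_1),\dots,(X_n,Y_n)$, $n\ge 2$, be i.i.d. with $X_i\in\mathbb{R}^p$ and $Y_i=\beta^TX_i+\epsilon_i$, where $\beta\in\mathbb{R}^p$, $E(\epsilon_i\mid X_i)=0$, $E(\epsilon_i^2\mid X_i)=\sigma^2$, $E(X_i)=\mathbf{0}$, $\mathrm{Cov}(X_i)=\mathbf{I}$, and the distribution of $X_i$ is known. Assume additionally that $X_i$ has moments of all orders. Then the oracle estimator $$T_{oracle}=\hat\tau^2-2\sum_{j=1}^p\sum_{j'=1}^p\psi_{jj'}$$ is an optimal oracle estimator (OOE) of $\tau^2=\|\beta\|^2$ with respect to the family of zero-estimators $\mathcal{G}$; that is, for all values of the unknown parameters, $\mathrm{Var}(T_{oracle})\le\mathrm{Var}(\hat\tau^2+g)$ for every $g\in\mathcal{G}$.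
   Context: Notation: $W_{ij}=X_{ij}Y_i$; the naive estimator is $\hat\tau^2=\frac{1}{n(n-1)}\sum_{j=1}^p\sum_{i_1\ne i_2}W_{i_1j}W_{i_2j}$ (an unbiased estimator of $\tau^2=\|\beta\|^2$). Further, $\psi_{jj'}=\beta_j\beta_{j'}h_{jj'}$ with $h_{jj'}=\frac1n\sum_{i=1}^n[X_{ij}X_{ij'}-E(X_{ij}X_{ij'})]$. $\mathcal{G}$ is the set of all finite real linear combinations of the zero-estimators $g_{k_1\ldots k_p}=\frac1n\sum_{i=1}^n[X_{i1}^{k_1}\cdots X_{ip}^{k_p}-E(X_{i1}^{k_1}\cdots X_{ip}^{k_p})]$, $(k_1,\dots,k_p)\in\{0,1,2,\dots\}^p$. An OOE of a quantity $\theta$ with respect to $\mathcal{G}$, for an unbiased initial estimator $T$, is $R^*=T+g^*$ with $g^*\in\mathcal{G}$ (coefficients of $g^*$ possibly depending on the unknown parameters) such that $\mathrm{Var}[T+g^*]\le\mathrm{Var}[T+g]$ for all $g\in\mathcal{G}$ and all parameter values. Here $T=\hat\tau^2$. *)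

theory Defs
  imports "HOL-Probability.Probability"
begin

text \<open>
  The errors are \<open>Y i - \<beta> \<bullet> X i\<close>. \<open>D\<close> is the known law of the covariates. The
  integrability assumptions on the errors are part of the existence of the two conditional
  expectations; they are explicit because \<^const>\<open>real_cond_exp\<close> is total. The assumption on
  moments of all orders covers all mixed moments.
\<close>

locale linear_model = prob_space M
  for M :: "'a measure" +
  fixes n :: nat
    and D :: "(real ^ 'p) measure"
    and X :: "nat \<Rightarrow> 'a \<Rightarrow> real ^ 'p"
    and Y :: "nat \<Rightarrow> 'a \<Rightarrow> real"
    and \<beta> :: "real ^ 'p"
    and \<sigma> :: real
  assumes sample_size: "n \<ge> 2"
    and indep: "indep_vars (\<lambda>_. borel) (\<lambda>i \<omega>. (X i \<omega>, Y i \<omega>)) {1..n}"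
    and ident: "\<And>i i'. i \<in> {1..n} \<Longrightarrow> i' \<in> {1..n} \<Longrightarrow>
      distr M borel (\<lambda>\<omega>. (X i \<omega>, Y i \<omega>)) = distr M borel (\<lambda>\<omega>. (X i' \<omega>, Y i' \<omega>))"
    and covariate_law: "\<And>i. i \<in> {1..n} \<Longrightarrow> distr M borel (X i) = D"
    and moments: "\<And>k :: 'p \<Rightarrow> nat. integrable D (\<lambda>x. \<Prod>j\<in>UNIV. x $ j ^ k j)"
    and mean: "(\<integral>x. x \<partial>D) = 0"
    and covariance: "(\<chi> j j'. \<integral>x. (x $ j - (\<integral>z. z $ j \<partial>D)) * (x $ j' - (\<integral>z. z $ j' \<partial>D)) \<partial>D)
      = (mat 1 :: real ^ 'p ^ 'p)"
    and error_integrable: "\<And>i. i \<in> {1..n} \<Longrightarrow> integrable M (\<lambda>\<omega>. Y i \<omega> - \<beta> \<bullet> X i \<omega>)"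
    and error_sq_integrable: "\<And>i. i \<in> {1..n} \<Longrightarrow> integrable M (\<lambda>\<omega>. (Y i \<omega> - \<beta> \<bullet> X i \<omega>)\<^sup>2)"
    and error_mean: "\<And>i. i \<in> {1..n} \<Longrightarrow>
      AE \<omega> in M. real_cond_exp M (vimage_algebra (space M) (X i) borel)
        (\<lambda>\<omega>. Y i \<omega> - \<beta> \<bullet> X i \<omega>) \<omega> = 0"
    and error_variance: "\<And>i. i \<in> {1..n} \<Longrightarrow>
      AE \<omega> in M. real_cond_exp M (vimage_algebra (space M) (X i) borel)
        (\<lambda>\<omega>. (Y i \<omega> - \<beta> \<bullet> X i \<omega>)\<^sup>2) \<omega> = \<sigma>\<^sup>2"

definition W :: "(nat \<Rightarrow> 'a \<Rightarrow> real ^ 'p) \<Rightarrow> (nat \<Rightarrow> 'a \<Rightarrow> real) \<Rightarrow> nat \<Rightarrow> 'p \<Rightarrow> 'a \<Rightarrow> real" where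
  "W X Y i j \<omega> = X i \<omega> $ j * Y i \<omega>"

definition naive_estimator ::
  "nat \<Rightarrow> (nat \<Rightarrow> 'a \<Rightarrow> real ^ 'p) \<Rightarrow> (nat \<Rightarrow> 'a \<Rightarrow> real) \<Rightarrow> 'a \<Rightarrow> real" where
  "naive_estimator n X Y \<omega> = 1 / (real n * (real n - 1)) *
     (\<Sum>j\<in>UNIV. \<Sum>i\<^sub>1\<in>{1..n}. \<Sum>i\<^sub>2\<in>{1..n} - {i\<^sub>1}. W X Y i\<^sub>1 j \<omega> * W X Y i\<^sub>2 j \<omega>)"

text \<open>
  Expectations of functions of a single covariate vector are taken under the known law \<open>D\<close>, so
  that the zero-estimators are statistics that do not involve unknown parameters.
\<close>

definition h ::
  "nat \<Rightarrow> (real ^ 'p) measure \<Rightarrow> (nat \<Rightarrow> 'a \<Rightarrow> real ^ 'p) \<Rightarrow> 'p \<Rightarrow> 'p \<Rightarrow> 'a \<Rightarrow> real" where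
  "h n D X j j' \<omega> = 1 / real n *
     (\<Sum>i\<in>{1..n}. (X i \<omega> $ j * X i \<omega> $ j' - (\<integral>x. x $ j * x $ j' \<partial>D)))"

definition psi ::
  "nat \<Rightarrow> (real ^ 'p) measure \<Rightarrow> (nat \<Rightarrow> 'a \<Rightarrow> real ^ 'p) \<Rightarrow> real ^ 'p \<Rightarrow> 'p \<Rightarrow> 'p \<Rightarrow> 'a \<Rightarrow> real" where
  "psi n D X \<beta> j j' \<omega> = \<beta> $ j * \<beta> $ j' * h n D X j j' \<omega>"

definition oracle_estimator ::
  "nat \<Rightarrow> (real ^ 'p) measure \<Rightarrow> (nat \<Rightarrow> 'a \<Rightarrow> real ^ 'p) \<Rightarrow> (nat \<Rightarrow> 'a \<Rightarrow> real) \<Rightarrow>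
    real ^ 'p \<Rightarrow> 'a \<Rightarrow> real" where
  "oracle_estimator n D X Y \<beta> \<omega> =
     naive_estimator n X Y \<omega> - 2 * (\<Sum>j\<in>UNIV. \<Sum>j'\<in>UNIV. psi n D X \<beta> j j' \<omega>)"

definition monomial_zero_estimator ::
  "nat \<Rightarrow> (real ^ 'p) measure \<Rightarrow> (nat \<Rightarrow> 'a \<Rightarrow> real ^ 'p) \<Rightarrow> ('p \<Rightarrow> nat) \<Rightarrow> 'a \<Rightarrow> real" where
  "monomial_zero_estimator n D X k \<omega> = 1 / real n *
     (\<Sum>i\<in>{1..n}. ((\<Prod>j\<in>UNIV. X i \<omega> $ j ^ k j) - (\<integral>x. (\<Prod>j\<in>UNIV. x $ j ^ k j) \<partial>D)))"

definition zero_estimators ::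
  "nat \<Rightarrow> (real ^ 'p) measure \<Rightarrow> (nat \<Rightarrow> 'a \<Rightarrow> real ^ 'p) \<Rightarrow> ('a \<Rightarrow> real) set" where
  "zero_estimators n D X =
     {\<lambda>\<omega>. \<Sum>k\<in>K. c k * monomial_zero_estimator n D X k \<omega> | K c. finite K}"

definition unbiased_estimator ::
  "'t set \<Rightarrow> ('t \<Rightarrow> 'a measure) \<Rightarrow> ('t \<Rightarrow> real) \<Rightarrow> ('a \<Rightarrow> real) \<Rightarrow> bool" where
  "unbiased_estimator \<Theta> M q T \<longleftrightarrow>
     (\<forall>\<theta>\<in>\<Theta>. integrable (M \<theta>) T \<and> prob_space.expectation (M \<theta>) T = q \<theta>)"

text \<open>
  \<open>\<Theta>\<close> is the set of parameter values, \<open>M \<theta>\<close> the probability measure at \<open>\<theta>\<close>, and \<open>q \<theta>\<close> the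
  estimated quantity. The estimator \<open>R\<close> may depend on \<open>\<theta>\<close>; the initial estimator \<open>T\<close> and the
  family \<open>G\<close> may not. The square-integrability clause makes the variances genuine, since
  the integral of a non-integrable function is 0.
\<close>

definition optimal_oracle_estimator ::
  "'t set \<Rightarrow> ('t \<Rightarrow> 'a measure) \<Rightarrow> ('t \<Rightarrow> real) \<Rightarrow> ('a \<Rightarrow> real) \<Rightarrow> ('a \<Rightarrow> real) set \<Rightarrow>
    ('t \<Rightarrow> 'a \<Rightarrow> real) \<Rightarrow> bool" where
  "optimal_oracle_estimator \<Theta> M q T G R \<longleftrightarrow>
     unbiased_estimator \<Theta> M q T \<and>
     (\<forall>\<theta>\<in>\<Theta>. \<forall>g\<in>G. integrable (M \<theta>) (\<lambda>\<omega>. T \<omega> + g \<omega>) \<and> integrable (M \<theta>) (\<lambda>\<omega>. (T \<omega> + g \<omega>)\<^sup>2)) \<and>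
     (\<forall>\<theta>\<in>\<Theta>. \<exists>g\<in>G. R \<theta> = (\<lambda>\<omega>. T \<omega> + g \<omega>)) \<and>
     (\<forall>\<theta>\<in>\<Theta>. \<forall>g\<in>G. prob_space.variance (M \<theta>) (R \<theta>) \<le> prob_space.variance (M \<theta>) (\<lambda>\<omega>. T \<omega> + g \<omega>))"

end

theory Submission
  imports Defs
begin

text \<open>
  Every \<open>g \<in> zero_estimators n D X\<close> is the average of \<open>f (X i) - E f\<close> for a polynomial \<open>f\<close>, and the
  oracle estimator \<open>R\<close> is the naive estimator \<open>T\<close> plus such an average for
  \<open>f x = - 2 (\<beta> \<bullet> x)\<^sup>2\<close>. In \<open>E (T g)\<close> only the terms in which the index of \<open>X i\<close> is one of the two
  indices of \<open>T\<close> survive, so \<open>E (T g) = 2 / n * Cov ((\<beta> \<bullet> x)\<^sup>2, f)\<close>, which the correction cancels.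
  Hence \<open>E (R g) = 0\<close> for all \<open>g\<close>, and since \<open>T + g - R\<close> is again a zero-estimator, Pythagoras
  gives \<open>Var (T + g) = Var R + Var (T + g - R)\<close>.
\<close>

section \<open>Square integrability, orthogonality and conditional expectation\<close>

text \<open>Measurability is a separate demand because it does not follow from that of the square.
  With it the class is closed under sums and scalar multiples, and products of two members are
  integrable.\<close>

definition square_integrable :: "'a measure \<Rightarrow> ('a \<Rightarrow> real) \<Rightarrow> bool" where
  "square_integrable M f \<longleftrightarrow> f \<in> borel_measurable M \<and> integrable M (\<lambda>x. (f x)\<^sup>2)"

lemma square_integrable_mult:
  assumes "square_integrable M f" "square_integrable M g"
  shows "integrable M (\<lambda>x. f x * g x)"
proof (rule Bochner_Integration.integrable_bound)
  show "integrable M (\<lambda>x. (f x)\<^sup>2 + (g x)\<^sup>2)"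
    using assms by (auto simp: square_integrable_def)
  show "(\<lambda>x. f x * g x) \<in> borel_measurable M"
    using assms by (auto simp: square_integrable_def)
  have "\<bar>f x * g x\<bar> \<le> (f x)\<^sup>2 + (g x)\<^sup>2" for x
    using sum_squares_bound[of "\<bar>f x\<bar>" "\<bar>g x\<bar>"] abs_ge_zero[of "f x * g x"]
    unfolding abs_mult power2_abs by linarith
  then show "AE x in M. norm (f x * g x) \<le> norm ((f x)\<^sup>2 + (g x)\<^sup>2)"
    by (auto intro: order_trans[OF _ abs_ge_self])
qed

lemma square_integrable_add:
  assumes "square_integrable M f" "square_integrable M g"
  shows "square_integrable M (\<lambda>x. f x + g x)"
  using assms square_integrable_mult[OF assms]
  by (auto simp: square_integrable_def power2_sum mult.assoc)

lemma square_integrable_cmult: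
  "square_integrable M f \<Longrightarrow> square_integrable M (\<lambda>x. c * f x)"
  by (auto simp: square_integrable_def power_mult_distrib)

lemma square_integrable_sum:
  "(\<And>i. i \<in> I \<Longrightarrow> square_integrable M (f i)) \<Longrightarrow> square_integrable M (\<lambda>x. \<Sum>i\<in>I. f i x)"
proof (induction I rule: infinite_finite_induct)
  case (insert i I)
  then show ?case by (simp add: square_integrable_add)
qed (simp_all add: square_integrable_def)

lemma (in finite_measure) square_integrable_integrable:
  "square_integrable M f \<Longrightarrow> integrable M f"
  using square_integrable_imp_integrable by (auto simp: square_integrable_def)

text \<open>Made for the naive estimator: the innermost set may depend on the middle index because
  there it is \<open>{1..n} - {i}\<close>, so integrability is asked of off-diagonal products
  only.\<close>

lemma integral_triple_sum:
  fixes f :: "'b \<Rightarrow> 'c \<Rightarrow> 'd \<Rightarrow> 'a \<Rightarrow> real"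
  assumes int: "\<And>i j k. i \<in> I \<Longrightarrow> j \<in> J \<Longrightarrow> k \<in> K j \<Longrightarrow> integrable M (f i j k)"
  shows "(\<integral>x. (\<Sum>i\<in>I. \<Sum>j\<in>J. \<Sum>k\<in>K j. f i j k x) \<partial>M) = (\<Sum>i\<in>I. \<Sum>j\<in>J. \<Sum>k\<in>K j. \<integral>x. f i j k x \<partial>M)"
proof -
  have inner: "integrable M (\<lambda>x. \<Sum>k\<in>K j. f i j k x)" if "i \<in> I" "j \<in> J" for i j
    using int[OF that] by (rule Bochner_Integration.integrable_sum)
  have "(\<integral>x. (\<Sum>i\<in>I. \<Sum>j\<in>J. \<Sum>k\<in>K j. f i j k x) \<partial>M) = (\<Sum>i\<in>I. \<integral>x. (\<Sum>j\<in>J. \<Sum>k\<in>K j. f i j k x) \<partial>M)"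
    by (intro Bochner_Integration.integral_sum Bochner_Integration.integrable_sum inner)
  also have "\<dots> = (\<Sum>i\<in>I. \<Sum>j\<in>J. \<integral>x. (\<Sum>k\<in>K j. f i j k x) \<partial>M)"
    by (intro sum.cong refl Bochner_Integration.integral_sum inner)
  also have "\<dots> = (\<Sum>i\<in>I. \<Sum>j\<in>J. \<Sum>k\<in>K j. \<integral>x. f i j k x \<partial>M)"
    by (intro sum.cong refl Bochner_Integration.integral_sum int)
  finally show ?thesis .
qed

text \<open>The cross term vanishes from the second moment and the mean stays the same, so adding
  \<open>g\<close> raises the variance by \<open>E g^2\<close>.\<close>

lemma (in prob_space) variance_le_orthogonal:
  assumes f: "square_integrable M f" and g: "square_integrable M g"
    and mean: "expectation g = 0" and orth: "expectation (\<lambda>\<omega>. f \<omega> * g \<omega>) = 0"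
  shows "variance f \<le> variance (\<lambda>\<omega>. f \<omega> + g \<omega>)"
proof -
  note fg = square_integrable_add[OF f g]
  have f2: "integrable M (\<lambda>\<omega>. (f \<omega>)\<^sup>2)" and g2: "integrable M (\<lambda>\<omega>. (g \<omega>)\<^sup>2)"
    using f g by (auto simp: square_integrable_def)
  have "expectation (\<lambda>\<omega>. (f \<omega> + g \<omega>)\<^sup>2)
      = expectation (\<lambda>\<omega>. (f \<omega>)\<^sup>2 + (g \<omega>)\<^sup>2 + 2 * (f \<omega> * g \<omega>))"
    by (simp add: power2_sum mult.assoc)
  also have "\<dots> = expectation (\<lambda>\<omega>. (f \<omega>)\<^sup>2) + expectation (\<lambda>\<omega>. (g \<omega>)\<^sup>2)"
    using f2 g2 square_integrable_mult[OF f g] orth by simp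
  finally have "expectation (\<lambda>\<omega>. (f \<omega> + g \<omega>)\<^sup>2)
      = expectation (\<lambda>\<omega>. (f \<omega>)\<^sup>2) + expectation (\<lambda>\<omega>. (g \<omega>)\<^sup>2)" .
  moreover have "expectation (\<lambda>\<omega>. f \<omega> + g \<omega>) = expectation f"
    using square_integrable_integrable[OF f] square_integrable_integrable[OF g] mean by simp
  moreover have "0 \<le> expectation (\<lambda>\<omega>. (g \<omega>)\<^sup>2)" by simp
  ultimately show ?thesis
    using variance_eq[OF square_integrable_integrable[OF f] f2]
      variance_eq[OF square_integrable_integrable[OF fg]] fg
    by (simp add: square_integrable_def)
qed

text \<open>
  \<open>real_cond_exp_intg\<close> presupposes that the product is integrable. This is needed to obtain
  \<open>E (X\<^sub>j\<^sup>2 \<epsilon>\<^sup>2) < \<infinity>\<close> from the conditional variance alone, without a fourth moment of \<open>\<epsilon>\<close>.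
\<close>

lemma (in sigma_finite_subalgebra) integrable_mult_real_cond_exp:
  assumes f [measurable]: "f \<in> borel_measurable F" and g: "integrable M g"
    and f_nonneg: "\<And>x. f x \<ge> 0" and g_nonneg: "\<And>x. g x \<ge> 0"
    and int: "integrable M (\<lambda>x. f x * real_cond_exp M F g x)"
  shows "integrable M (\<lambda>x. f x * g x)"
proof (rule integrableI_bounded)
  have fM [measurable]: "f \<in> borel_measurable M" by (rule measurable_from_subalg[OF subalg f])
  have gM [measurable]: "g \<in> borel_measurable M" using g by simp
  show "(\<lambda>x. f x * g x) \<in> borel_measurable M" by measurable
  \<comment> \<open>For the extended nonnegative conditional expectation the defining identity needs
    no integrability. To return to \<open>real_cond_exp\<close>, a difference of real values of two
    such expectations, the part of \<open>g\<close> must be finite and the part of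
    \<open>- g\<close> zero almost everywhere.\<close>
  let ?N = "nn_cond_exp M F (\<lambda>x. ennreal (g x))"
  have "(\<integral>\<^sup>+x. ?N x \<partial>M) = (\<integral>\<^sup>+x. ennreal (g x) \<partial>M)"
    using nn_cond_exp_intg[of "\<lambda>_. 1" "\<lambda>x. ennreal (g x)"] by simp
  also have "\<dots> < \<infinity>" using integrableD(2)[OF g] g_nonneg by (simp add: less_top)
  finally have fin: "AE x in M. ?N x \<noteq> \<infinity>"
    by (intro nn_integral_PInf_AE) auto
  have zero: "AE x in M. nn_cond_exp M F (\<lambda>x. ennreal (- g x)) x = 0"
  proof -
    have "AE x in M. (\<lambda>_. 0::ennreal) x = nn_cond_exp M F (\<lambda>_. 0) x"
      by (rule nn_cond_exp_F_meas) simp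
    moreover have "(\<lambda>x. ennreal (- g x)) = (\<lambda>_. 0)"
      using g_nonneg by (auto simp: ennreal_neg)
    ultimately show ?thesis by auto
  qed
  have eq: "AE x in M. ?N x = ennreal (real_cond_exp M F g x)"
    using fin zero by eventually_elim (auto simp: real_cond_exp_def less_top)
  have "(\<integral>\<^sup>+x. ennreal (norm (f x * g x)) \<partial>M) = (\<integral>\<^sup>+x. ennreal (f x) * ennreal (g x) \<partial>M)"
    using f_nonneg g_nonneg by (simp add: ennreal_mult)
  also have "\<dots> = (\<integral>\<^sup>+x. ennreal (f x) * ?N x \<partial>M)"
    by (rule nn_cond_exp_intg[symmetric]) auto
  also have "\<dots> = (\<integral>\<^sup>+x. ennreal (f x * real_cond_exp M F g x) \<partial>M)"
    using eq by (intro nn_integral_cong_AE) (auto simp: ennreal_mult' f_nonneg)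
  also have "\<dots> < \<infinity>" using integrableD(2)[OF int] by (simp add: less_top)
  finally show "(\<integral>\<^sup>+x. ennreal (norm (f x * g x)) \<partial>M) < \<infinity>" .
qed

section \<open>Polynomials, their averages, and two finite sums\<close>

lemma monomial_mult_coordinate:
  fixes x :: "'a::comm_monoid_mult ^ 'p"
  shows "x $ j * (\<Prod>l\<in>UNIV. x $ l ^ k l) = (\<Prod>l\<in>UNIV. x $ l ^ (k l + (if l = j then 1 else 0)))"
proof -
  have "(\<Prod>l\<in>UNIV. x $ l ^ (if l = j then 1 else 0)) = (\<Prod>l\<in>UNIV. if l = j then x $ l else 1)"
    by (rule prod.cong) auto
  also have "\<dots> = x $ j" by simp
  finally show ?thesis by (simp add: power_add prod.distrib mult.commute)
qed

text \<open>Induction on the construction of \<open>f\<close> avoids any normal form. The free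
  factor \<open>u\<close> carries the product case: the hypothesis for \<open>g\<close> absorbs
  \<open>g\<close> into \<open>u\<close>, then that for \<open>f\<close> applies to the new factor.
  The exponents \<open>k\<close> vary because the linear case raises them. With \<open>u = 1\<close>
  and \<open>k = 0\<close> this gives integrability of \<open>f\<close> itself.\<close>

lemma integrable_real_polynomial_function_mult:
  fixes f :: "real ^ 'p \<Rightarrow> real"
  assumes "real_polynomial_function f"
    and "\<And>k. integrable D (\<lambda>x. u x * (\<Prod>j\<in>UNIV. x $ j ^ k j))"
  shows "integrable D (\<lambda>x. f x * u x * (\<Prod>j\<in>UNIV. x $ j ^ k j))"
  using assms
proof (induction f arbitrary: u k rule: real_polynomial_function.induct)
  case (linear f)
  have f: "f x = (\<Sum>j\<in>UNIV. f (axis j 1) * x $ j)" for x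
  proof -
    interpret bounded_linear f by fact
    have "f x = f (\<Sum>j\<in>UNIV. x $ j *\<^sub>R axis j 1)"
      using basis_expansion[of x] by (simp add: scalar_mult_eq_scaleR)
    then show ?thesis by (simp add: sum scaleR mult.commute)
  qed
  \<comment> \<open>Each coordinate of the linear form is absorbed into the monomial by raising one
    exponent, which returns every summand to the hypothesis on \<open>u\<close>.\<close>
  have "(\<lambda>x. f x * u x * (\<Prod>j\<in>UNIV. x $ j ^ k j)) = (\<lambda>x. \<Sum>j\<in>UNIV. f (axis j 1) *
      (u x * (\<Prod>l\<in>UNIV. x $ l ^ (k l + (if l = j then 1 else 0)))))"
    by (subst f) (simp only: monomial_mult_coordinate[symmetric] sum_distrib_left sum_distrib_right mult_ac)
  then show ?case using linear.prems by auto
next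
  case (const c)
  then show ?case by (simp add: mult.assoc)
next
  case (add f g)
  then show ?case by (simp add: distrib_right)
next
  case (mult f g)
  from mult.IH(1)[OF mult.IH(2)[OF mult.prems]] show ?case by (simp add: mult.assoc)
qed

text \<open>One form for the monomial zero-estimators, for \<open>h\<close> and for the oracle
  correction, so that linearity and orthogonality are proved once for all polynomials.\<close>

definition zero_average ::
  "nat \<Rightarrow> (real ^ 'p) measure \<Rightarrow> (nat \<Rightarrow> 'a \<Rightarrow> real ^ 'p) \<Rightarrow> (real ^ 'p \<Rightarrow> real) \<Rightarrow> 'a \<Rightarrow> real" where
  "zero_average n D X f \<omega> = 1 / real n * (\<Sum>i\<in>{1..n}. (f (X i \<omega>) - (\<integral>x. f x \<partial>D)))"

lemma real_polynomial_function_nth: "real_polynomial_function (\<lambda>x :: real ^ 'p. x $ j)"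
  by (rule real_polynomial_function.intros(1)) (rule bounded_linear_vec_nth)

lemma real_polynomial_function_inner: "real_polynomial_function (\<lambda>x :: real ^ 'p. b \<bullet> x)"
  by (rule real_polynomial_function.intros(1)) (rule bounded_linear_inner_right)

lemmas real_polynomial_function_intros =
  real_polynomial_function.intros(2-4) real_polynomial_function_nth real_polynomial_function_inner
  real_polynomial_function_power real_polynomial_function_diff

lemma real_polynomial_function_measurable:
  assumes "real_polynomial_function (f :: real ^ 'p \<Rightarrow> real)"
  shows "f \<in> borel_measurable borel"
  using assms
  by (intro borel_measurable_continuous_onI continuous_on_polymonial_function)
    (simp add: real_polynomial_function_eq)

text \<open>The index \<open>k\<close> can stand in either place, and each leaves
  \<open>card I - 1\<close> choices for the other. This is the source of the factor 2 in the oracle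
  correction.\<close>

lemma sum_pairs_containing:
  assumes "k \<in> I" "finite I"
  shows "(\<Sum>i\<in>I. \<Sum>i'\<in>I - {i}. if k = i \<or> k = i' then c else 0) = 2 * (real (card I) - 1) * (c::real)"
proof -
  have card: "real (card (I - {k})) = real (card I) - 1" if "k \<in> I" for k
    using that assms(2) card_gt_0_iff[of I] by (auto simp: Suc_le_eq)
  have "(\<Sum>i'\<in>I - {i}. if k = i \<or> k = i' then c else 0)
      = (if k = i then (real (card I) - 1) * c else c)" if "i \<in> I" for i
    using that assms card by (cases "k = i") simp_all
  then have "(\<Sum>i\<in>I. \<Sum>i'\<in>I - {i}. if k = i \<or> k = i' then c else 0)
      = (\<Sum>i\<in>I. if k = i then (real (card I) - 1) * c else c)"
    by (rule sum.cong[OF refl])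
  also have "\<dots> = (real (card I) - 1) * c + (\<Sum>i\<in>I - {k}. if k = i then (real (card I) - 1) * c else c)"
    using assms by (subst sum.remove[of _ k]) auto
  also have "\<dots> = (real (card I) - 1) * c + (\<Sum>i\<in>I - {k}. c)"
    by (intro arg_cong2[of _ _ _ _ "(+)"] sum.cong refl) auto
  also have "\<dots> = 2 * (real (card I) - 1) * c"
    by (simp only: sum_constant card[OF assms(1)])
  finally show ?thesis .
qed

text \<open>A single sum over pairs fits linearity over one finite index set, as in
  \<open>zero_average_linear_combination\<close>.\<close>

lemma inner_power2_expand:
  "(b \<bullet> x)\<^sup>2 = (\<Sum>(j, j')\<in>UNIV. b $ j * b $ j' * (x $ j * x $ j'))" for b x :: "real ^ 'p"
  by (simp add: power2_eq_square inner_vec_def sum_product sum.cartesian_product mult_ac)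

section \<open>Moments of the covariates, on the sample space and under \<open>D\<close>\<close>

context linear_model
begin

lemma measurable_pair: "i \<in> {1..n} \<Longrightarrow> (\<lambda>\<omega>. (X i \<omega>, Y i \<omega>)) \<in> borel_measurable M"
  using indep by (auto simp: indep_vars_def2)

lemma measurable_X: "i \<in> {1..n} \<Longrightarrow> X i \<in> borel_measurable M"
  using measurable_compose[OF measurable_pair, of i fst borel]
  by (simp add: borel_measurable_continuous_onI continuous_on_fst)

lemma prob_space_D: "prob_space D"
  using covariate_law[of 1] prob_space_distr[OF measurable_X[of 1]] sample_size by auto

lemma integrable_X_iff:
  assumes "i \<in> {1..n}" "f \<in> borel_measurable borel"
  shows "integrable M (\<lambda>\<omega>. f (X i \<omega>) :: real) \<longleftrightarrow> integrable D f"
  using integrable_distr_eq[OF measurable_X[OF assms(1)] assms(2)] covariate_law[OF assms(1)] by simp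

lemma expectation_X:
  assumes "i \<in> {1..n}" "f \<in> borel_measurable borel"
  shows "expectation (\<lambda>\<omega>. f (X i \<omega>) :: real) = (\<integral>x. f x \<partial>D)"
  using integral_distr[OF measurable_X[OF assms(1)] assms(2)] covariate_law[OF assms(1)] by simp

lemma integrable_D_polynomial: "real_polynomial_function f \<Longrightarrow> integrable D f"
  using integrable_real_polynomial_function_mult[of f D "\<lambda>_. 1" "\<lambda>_. 0"] moments by simp

lemma integrable_polynomial:
  "i \<in> {1..n} \<Longrightarrow> real_polynomial_function f \<Longrightarrow> integrable M (\<lambda>\<omega>. f (X i \<omega>))"
  by (simp add: integrable_X_iff real_polynomial_function_measurable integrable_D_polynomial)

lemma expectation_polynomial:
  "i \<in> {1..n} \<Longrightarrow> real_polynomial_function f \<Longrightarrow> expectation (\<lambda>\<omega>. f (X i \<omega>)) = (\<integral>x. f x \<partial>D)"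
  by (simp add: expectation_X real_polynomial_function_measurable)

lemma measurable_polynomial:
  "i \<in> {1..n} \<Longrightarrow> real_polynomial_function f \<Longrightarrow> (\<lambda>\<omega>. f (X i \<omega>)) \<in> borel_measurable M"
  by (rule measurable_compose[OF measurable_X real_polynomial_function_measurable])

lemma square_integrable_polynomial:
  "i \<in> {1..n} \<Longrightarrow> real_polynomial_function f \<Longrightarrow> square_integrable M (\<lambda>\<omega>. f (X i \<omega>))"
  using integrable_polynomial[OF _ real_polynomial_function_power, of i f 2] measurable_polynomial
  by (auto simp: square_integrable_def)

text \<open>The mean is a vector-valued integral, and coordinates commute with it only if the
  identity is integrable; this follows by expanding the vector along the axes. With all coordinate
  means zero, the covariance matrix is the matrix of second moments.\<close>

lemma second_moments: "(\<integral>x. x $ j * x $ j' \<partial>D) = (if j = j' then 1 else 0)"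
proof -
  have int: "integrable D (\<lambda>x. x $ l)" for l
    by (intro integrable_D_polynomial real_polynomial_function_intros)
  have "integrable D (\<lambda>x. \<Sum>l\<in>UNIV. x $ l *\<^sub>R axis l (1::real))"
    using int by (intro Bochner_Integration.integrable_sum integrable_scaleR_left) auto
  moreover have "(\<Sum>l\<in>UNIV. x $ l *\<^sub>R axis l (1::real)) = x" for x :: "real ^ 'p"
    using basis_expansion[of x] by (simp add: scalar_mult_eq_scaleR)
  ultimately have "integrable D (\<lambda>x. x)" by simp
  then have "(\<integral>x. x $ l \<partial>D) = 0" for l
    using integral_bounded_linear[OF bounded_linear_vec_nth[of l], of D "\<lambda>x. x"] mean by simp
  moreover have "(\<integral>x. (x $ j - (\<integral>z. z $ j \<partial>D)) * (x $ j' - (\<integral>z. z $ j' \<partial>D)) \<partial>D)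
      = (mat 1 :: real ^ 'p ^ 'p) $ j $ j'"
    unfolding covariance[symmetric] by simp
  ultimately show ?thesis by (simp add: mat_def)
qed

section \<open>Errors and responses weighted by polynomials of the covariates\<close>

lemma finite_measure_subalgebra_X:
  assumes "i \<in> {1..n}"
  shows "finite_measure_subalgebra M (vimage_algebra (space M) (X i) borel)"
proof
  show "subalgebra M (vimage_algebra (space M) (X i) borel)"
    unfolding subalgebra_def using measurable_X[OF assms]
    by (auto simp: measurable_iff_sets)
qed

lemma measurable_polynomial_subalgebra:
  assumes "real_polynomial_function f"
  shows "(\<lambda>\<omega>. f (X i \<omega>)) \<in> borel_measurable (vimage_algebra (space M) (X i) borel)"
  by (rule measurable_compose[OF measurable_vimage_algebra1 real_polynomial_function_measurable])
    (use assms in auto)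

text \<open>Conditioning the squared error on \<open>X i\<close> replaces it by
  \<open>\<sigma>^2\<close>, and \<open>\<sigma>^2\<close> times a squared polynomial is integrable.
  Only the second moment of the error enters.\<close>

lemma square_integrable_polynomial_error:
  assumes i: "i \<in> {1..n}" and f: "real_polynomial_function f"
  shows "square_integrable M (\<lambda>\<omega>. f (X i \<omega>) * (Y i \<omega> - \<beta> \<bullet> X i \<omega>))"
proof -
  let ?F = "vimage_algebra (space M) (X i) borel"
  let ?e = "\<lambda>\<omega>. Y i \<omega> - \<beta> \<bullet> X i \<omega>"
  interpret F: finite_measure_subalgebra M ?F by (rule finite_measure_subalgebra_X[OF i])
  have f2: "real_polynomial_function (\<lambda>x. (f x)\<^sup>2)"
    by (intro real_polynomial_function_intros f)
  have "integrable M (\<lambda>\<omega>. (f (X i \<omega>))\<^sup>2 * real_cond_exp M ?F (\<lambda>\<omega>. (?e \<omega>)\<^sup>2) \<omega>)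
      \<longleftrightarrow> integrable M (\<lambda>\<omega>. (f (X i \<omega>))\<^sup>2 * \<sigma>\<^sup>2)"
    using error_variance[OF i] measurable_polynomial[OF i f]
      borel_measurable_cond_exp2[of M ?F "\<lambda>\<omega>. (?e \<omega>)\<^sup>2"]
    by (intro integrable_cong_AE) auto
  then have "integrable M (\<lambda>\<omega>. (f (X i \<omega>))\<^sup>2 * real_cond_exp M ?F (\<lambda>\<omega>. (?e \<omega>)\<^sup>2) \<omega>)"
    using integrable_polynomial[OF i f2] by simp
  then have "integrable M (\<lambda>\<omega>. (f (X i \<omega>))\<^sup>2 * (?e \<omega>)\<^sup>2)"
    by (rule F.integrable_mult_real_cond_exp[OF measurable_polynomial_subalgebra[OF f2]
          error_sq_integrable[OF i], rotated 2]) simp_all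
  then show ?thesis
    using measurable_polynomial[OF i f] borel_measurable_integrable[OF error_integrable[OF i]]
    by (auto simp: square_integrable_def power_mult_distrib)
qed

text \<open>The factor \<open>f (X i)\<close> comes out of the conditional expectation given
  \<open>X i\<close>, where the error averages to zero.\<close>

lemma expectation_polynomial_error:
  assumes i: "i \<in> {1..n}" and f: "real_polynomial_function f"
  shows "expectation (\<lambda>\<omega>. f (X i \<omega>) * (Y i \<omega> - \<beta> \<bullet> X i \<omega>)) = 0"
proof -
  let ?F = "vimage_algebra (space M) (X i) borel"
  let ?e = "\<lambda>\<omega>. Y i \<omega> - \<beta> \<bullet> X i \<omega>"
  interpret F: finite_measure_subalgebra M ?F by (rule finite_measure_subalgebra_X[OF i])
  have "expectation (\<lambda>\<omega>. f (X i \<omega>) * ?e \<omega>)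
      = expectation (\<lambda>\<omega>. f (X i \<omega>) * real_cond_exp M ?F ?e \<omega>)"
    using square_integrable_integrable[OF square_integrable_polynomial_error[OF i f]]
      measurable_polynomial_subalgebra[OF f] error_integrable[OF i]
    by (intro F.real_cond_exp_intg(2)[symmetric]) auto
  also have "\<dots> = expectation (\<lambda>\<omega>. 0)"
    using error_mean[OF i] measurable_polynomial[OF i f]
    by (intro integral_cong_AE) auto
  finally show ?thesis by simp
qed

text \<open>Splitting the response as \<open>\<beta> \<bullet> X i\<close> plus error leaves a
  polynomial of \<open>X i\<close> and a polynomial multiple of the error.\<close>

lemma square_integrable_polynomial_Y:
  assumes "i \<in> {1..n}" "real_polynomial_function f"
  shows "square_integrable M (\<lambda>\<omega>. f (X i \<omega>) * Y i \<omega>)"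
proof -
  have "real_polynomial_function (\<lambda>x. f x * (\<beta> \<bullet> x))"
    by (intro real_polynomial_function_intros assms)
  from square_integrable_add[OF square_integrable_polynomial[OF assms(1) this]
      square_integrable_polynomial_error[OF assms]]
  show ?thesis by (simp add: algebra_simps)
qed

text \<open>By the same splitting, \<open>Y i\<close> may be replaced by
  \<open>\<beta> \<bullet> X i\<close> in expectation against any polynomial weight.\<close>

lemma expectation_polynomial_Y:
  assumes "i \<in> {1..n}" "real_polynomial_function f"
  shows "expectation (\<lambda>\<omega>. f (X i \<omega>) * Y i \<omega>) = (\<integral>x. f x * (\<beta> \<bullet> x) \<partial>D)"
proof -
  have p: "real_polynomial_function (\<lambda>x. f x * (\<beta> \<bullet> x))"
    by (intro real_polynomial_function_intros assms)
  have "expectation (\<lambda>\<omega>. f (X i \<omega>) * Y i \<omega>) = expectation (\<lambda>\<omega>. f (X i \<omega>) * (\<beta> \<bullet> X i \<omega>)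
      + f (X i \<omega>) * (Y i \<omega> - \<beta> \<bullet> X i \<omega>))"
    by (simp add: algebra_simps)
  also have "\<dots> = (\<integral>x. f x * (\<beta> \<bullet> x) \<partial>D)"
    using integrable_polynomial[OF assms(1) p] expectation_polynomial[OF assms(1) p]
      square_integrable_integrable[OF square_integrable_polynomial_error[OF assms]]
      expectation_polynomial_error[OF assms]
    by simp
  finally show ?thesis .
qed

section \<open>Independent observations and products of \<open>W\<close>\<close>

text \<open>Measurable functions of distinct observations remain independent. The functions act on
  the pairs \<open>(X i, Y i)\<close> because independence is assumed between pairs and not within
  them.\<close>

lemma
  assumes "J \<subseteq> {1..n}"
    and "\<And>i. i \<in> J \<Longrightarrow> \<phi> i \<in> borel_measurable borel"
    and "\<And>i. i \<in> J \<Longrightarrow> integrable M (\<lambda>\<omega>. \<phi> i (X i \<omega>, Y i \<omega>) :: real)"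
  shows integrable_prod_sample: "integrable M (\<lambda>\<omega>. \<Prod>i\<in>J. \<phi> i (X i \<omega>, Y i \<omega>))"
    and expectation_prod_sample: "expectation (\<lambda>\<omega>. \<Prod>i\<in>J. \<phi> i (X i \<omega>, Y i \<omega>))
      = (\<Prod>i\<in>J. expectation (\<lambda>\<omega>. \<phi> i (X i \<omega>, Y i \<omega>)))"
proof -
  have fin: "finite J" using assms(1) finite_subset by blast
  have "indep_vars (\<lambda>_. borel) (\<lambda>i \<omega>. \<phi> i (X i \<omega>, Y i \<omega>)) J"
    by (rule indep_vars_compose2[OF indep_vars_subset[OF indep assms(1)] assms(2)])
  then show "integrable M (\<lambda>\<omega>. \<Prod>i\<in>J. \<phi> i (X i \<omega>, Y i \<omega>))"
    and "expectation (\<lambda>\<omega>. \<Prod>i\<in>J. \<phi> i (X i \<omega>, Y i \<omega>))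
      = (\<Prod>i\<in>J. expectation (\<lambda>\<omega>. \<phi> i (X i \<omega>, Y i \<omega>)))"
    using indep_vars_integrable[OF fin] indep_vars_lebesgue_integral[OF fin] assms(3) by blast+
qed

lemma square_integrable_W: "i \<in> {1..n} \<Longrightarrow> square_integrable M (W X Y i j)"
  using square_integrable_polynomial_Y[OF _ real_polynomial_function_nth, of i j]
  by (simp add: W_def[abs_def])

text \<open>After \<open>Y i\<close> is replaced by \<open>\<beta> \<bullet> X i\<close>, the
  identity covariance singles out the coordinate \<open>j\<close> of \<open>\<beta>\<close>.\<close>

lemma expectation_W:
  assumes "i \<in> {1..n}"
  shows "expectation (W X Y i j) = \<beta> $ j"
proof -
  have int: "integrable D (\<lambda>x. x $ j * x $ l)" for l
    by (intro integrable_D_polynomial real_polynomial_function_intros)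
  have "(\<integral>x. x $ j * (\<beta> \<bullet> x) \<partial>D) = (\<integral>x. (\<Sum>l\<in>UNIV. \<beta> $ l * (x $ j * x $ l)) \<partial>D)"
    by (simp add: inner_vec_def sum_distrib_left mult_ac)
  also have "\<dots> = \<beta> $ j"
    using int by (simp add: second_moments if_distrib[where f = "(*) _"] cong: if_cong)
  finally show ?thesis
    using expectation_polynomial_Y[OF assms real_polynomial_function_nth, of j]
    by (simp add: W_def[abs_def])
qed

text \<open>For distinct indices the squared product is a product of two independent integrable
  squares; on the diagonal it would involve the fourth power of the response.\<close>

lemma square_integrable_W_mult_W:
  assumes "i \<in> {1..n}" "i' \<in> {1..n}" "i \<noteq> i'"
  shows "square_integrable M (\<lambda>\<omega>. W X Y i j \<omega> * W X Y i' j \<omega>)"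
proof -
  have "(\<lambda>z. (fst z $ j * snd z)\<^sup>2) \<in> borel_measurable (borel :: ((real ^ 'p) \<times> real) measure)"
    by (intro borel_measurable_continuous_onI continuous_intros)
  then have "integrable M (\<lambda>\<omega>. \<Prod>k\<in>{i, i'}. (\<lambda>z. (fst z $ j * snd z)\<^sup>2) (X k \<omega>, Y k \<omega>))"
    using assms square_integrable_W[of _ j]
    by (intro integrable_prod_sample) (auto simp: square_integrable_def W_def)
  moreover have "W X Y k j \<in> borel_measurable M" if "k \<in> {1..n}" for k
    using square_integrable_W[OF that] by (simp add: square_integrable_def)
  ultimately show ?thesis
    using assms by (auto simp: square_integrable_def W_def[abs_def] power_mult_distrib intro!: borel_measurable_times)
qed

lemma expectation_W_mult_W:
  assumes "i \<in> {1..n}" "i' \<in> {1..n}" "i \<noteq> i'"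
  shows "expectation (\<lambda>\<omega>. W X Y i j \<omega> * W X Y i' j \<omega>) = (\<beta> $ j)\<^sup>2"
proof -
  have meas: "(\<lambda>z. fst z $ j * snd z) \<in> borel_measurable (borel :: ((real ^ 'p) \<times> real) measure)"
    by (intro borel_measurable_continuous_onI continuous_intros)
  have W: "integrable M (\<lambda>\<omega>. X k \<omega> $ j * Y k \<omega>)" "expectation (\<lambda>\<omega>. X k \<omega> $ j * Y k \<omega>) = \<beta> $ j"
    if "k \<in> {1..n}" for k
    using square_integrable_integrable[OF square_integrable_W[OF that, of j]] expectation_W[OF that, of j]
    by (simp_all add: W_def[abs_def])
  have "expectation (\<lambda>\<omega>. \<Prod>k\<in>{i, i'}. (\<lambda>z. fst z $ j * snd z) (X k \<omega>, Y k \<omega>))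
      = (\<Prod>k\<in>{i, i'}. expectation (\<lambda>\<omega>. (\<lambda>z. fst z $ j * snd z) (X k \<omega>, Y k \<omega>)))"
    using assms W meas by (intro expectation_prod_sample) auto
  then show ?thesis
    using assms W by (simp add: W_def power2_eq_square)
qed

text \<open>If \<open>k\<close> differs from both indices, three independent factors remain and the
  centred \<open>f\<close> kills the product. If \<open>k\<close> equals one of them, the other
  \<open>W\<close> contributes \<open>\<beta> $ j\<close>, and \<open>f\<close> joins the coordinate
  as a polynomial weight on the response.\<close>

lemma expectation_W_mult_W_mult_polynomial:
  assumes i: "i \<in> {1..n}" "i' \<in> {1..n}" "i \<noteq> i'" and k: "k \<in> {1..n}"
    and f: "real_polynomial_function f" and mean_f: "(\<integral>x. f x \<partial>D) = 0"
  shows "expectation (\<lambda>\<omega>. W X Y i j \<omega> * W X Y i' j \<omega> * f (X k \<omega>))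
    = (if k = i \<or> k = i' then \<beta> $ j * (\<integral>x. x $ j * f x * (\<beta> \<bullet> x) \<partial>D) else 0)"
proof -
  have W_meas: "(\<lambda>z. fst z $ j * snd z) \<in> borel_measurable (borel :: ((real ^ 'p) \<times> real) measure)"
    by (intro borel_measurable_continuous_onI continuous_intros)
  have f_meas: "(\<lambda>z. f (fst z)) \<in> borel_measurable (borel :: ((real ^ 'p) \<times> real) measure)"
    by (rule measurable_compose[OF _ real_polynomial_function_measurable[OF f]])
      (intro borel_measurable_continuous_onI continuous_intros)
  have W: "integrable M (\<lambda>\<omega>. X l \<omega> $ j * Y l \<omega>)" "expectation (\<lambda>\<omega>. X l \<omega> $ j * Y l \<omega>) = \<beta> $ j"
    if "l \<in> {1..n}" for l
    using square_integrable_integrable[OF square_integrable_W[OF that, of j]] expectation_W[OF that, of j]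
    by (simp_all add: W_def[abs_def])
  have xf: "real_polynomial_function (\<lambda>x. x $ j * f x)"
    by (intro real_polynomial_function_intros f)
  \<comment> \<open>With \<open>a\<close> and \<open>b\<close> general, the two coincidences
    \<open>k = i\<close> and \<open>k = i'\<close> are instances with the roles swapped.\<close>
  have same: "expectation (\<lambda>\<omega>. W X Y a j \<omega> * W X Y b j \<omega> * f (X a \<omega>))
      = \<beta> $ j * (\<integral>x. x $ j * f x * (\<beta> \<bullet> x) \<partial>D)"
    if a: "a \<in> {1..n}" and b: "b \<in> {1..n}" and "a \<noteq> b" for a b
  proof -
    \<comment> \<open>The factor \<open>f\<close> is attached to observation \<open>a\<close>, so
      the product has one function per observation and independence applies.\<close>
    let ?\<phi> = "\<lambda>l z. if l = a then fst z $ j * snd z * f (fst z) else fst z $ j * snd z"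
    have "integrable M (\<lambda>\<omega>. X a \<omega> $ j * Y a \<omega> * f (X a \<omega>))"
      using square_integrable_integrable[OF square_integrable_polynomial_Y[OF a xf]]
      by (simp add: mult_ac)
    then have "expectation (\<lambda>\<omega>. \<Prod>l\<in>{a, b}. ?\<phi> l (X l \<omega>, Y l \<omega>))
        = (\<Prod>l\<in>{a, b}. expectation (\<lambda>\<omega>. ?\<phi> l (X l \<omega>, Y l \<omega>)))"
      using that W W_meas f_meas by (intro expectation_prod_sample) auto
    moreover have "expectation (\<lambda>\<omega>. X a \<omega> $ j * Y a \<omega> * f (X a \<omega>)) = (\<integral>x. x $ j * f x * (\<beta> \<bullet> x) \<partial>D)"
      using expectation_polynomial_Y[OF a xf] by (simp add: mult_ac)
    ultimately show ?thesis
      using that W by (simp add: W_def mult_ac)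
  qed
  show ?thesis
  proof (cases "k = i \<or> k = i'")
    case True
    then show ?thesis
      using same[OF i] same[OF i(2,1)] i by (auto simp: mult_ac)
  next
    case False
    let ?\<phi> = "\<lambda>l z. if l = k then f (fst z) else fst z $ j * snd z"
    have "expectation (\<lambda>\<omega>. \<Prod>l\<in>{i, i', k}. ?\<phi> l (X l \<omega>, Y l \<omega>))
        = (\<Prod>l\<in>{i, i', k}. expectation (\<lambda>\<omega>. ?\<phi> l (X l \<omega>, Y l \<omega>)))"
      using i k False W W_meas f_meas integrable_polynomial[OF k f]
      by (intro expectation_prod_sample) auto
    then show ?thesis
      using False i mean_f expectation_polynomial[OF k f] by (simp add: W_def mult.assoc)
  qed
qed

section \<open>Moments of the naive estimator\<close>

lemma square_integrable_naive_estimator: "square_integrable M (naive_estimator n X Y)"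
  unfolding naive_estimator_def[abs_def]
  by (intro square_integrable_cmult square_integrable_sum square_integrable_W_mult_W) auto

lemma expectation_naive_estimator: "expectation (naive_estimator n X Y) = (norm \<beta>)\<^sup>2"
proof -
  have "expectation (naive_estimator n X Y) = 1 / (real n * (real n - 1)) *
      (\<Sum>j\<in>UNIV. \<Sum>i\<in>{1..n}. \<Sum>i'\<in>{1..n} - {i}. expectation (\<lambda>\<omega>. W X Y i j \<omega> * W X Y i' j \<omega>))"
    unfolding naive_estimator_def[abs_def]
    by (subst integral_mult_right_zero, subst integral_triple_sum)
      (auto intro: square_integrable_integrable[OF square_integrable_W_mult_W])
  also have "\<dots> = 1 / (real n * (real n - 1)) *
      (\<Sum>j\<in>UNIV. \<Sum>i\<in>{1..n}. \<Sum>i'\<in>{1..n} - {i}. (\<beta> $ j)\<^sup>2)"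
    by (intro arg_cong2[of _ _ _ _ "(*)"] sum.cong refl expectation_W_mult_W) auto
  \<comment> \<open>For each \<open>j\<close> there are \<open>n * (n - 1)\<close> equal terms;
    \<open>n \<ge> 2\<close> keeps the normalising denominator nonzero.\<close>
  also have "\<dots> = (\<Sum>j\<in>UNIV. (\<beta> $ j)\<^sup>2)"
    using sample_size by (simp add: sum_distrib_left[symmetric])
  finally show ?thesis
    unfolding power2_norm_eq_inner by (simp add: inner_vec_def power2_eq_square)
qed

text \<open>Only the \<open>2 * (n - 1)\<close> ordered pairs containing \<open>k\<close> survive,
  and division by \<open>n * (n - 1)\<close> turns this count into \<open>2 / n\<close>.\<close>

lemma expectation_naive_estimator_mult_polynomial:
  assumes k: "k \<in> {1..n}" and f: "real_polynomial_function f" and mean_f: "(\<integral>x. f x \<partial>D) = 0"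
  shows "expectation (\<lambda>\<omega>. naive_estimator n X Y \<omega> * f (X k \<omega>))
    = 2 / real n * (\<integral>x. (\<beta> \<bullet> x)\<^sup>2 * f x \<partial>D)"
proof -
  let ?c = "\<lambda>j. \<integral>x. x $ j * f x * (\<beta> \<bullet> x) \<partial>D"
  have int: "integrable M (\<lambda>\<omega>. W X Y i j \<omega> * W X Y i' j \<omega> * f (X k \<omega>))"
    if "i \<in> {1..n}" "i' \<in> {1..n}" "i \<noteq> i'" for i i' j
    by (rule square_integrable_mult[OF square_integrable_W_mult_W[OF that] square_integrable_polynomial[OF k f]])
  have "expectation (\<lambda>\<omega>. naive_estimator n X Y \<omega> * f (X k \<omega>)) = 1 / (real n * (real n - 1)) *
      (\<Sum>j\<in>UNIV. \<Sum>i\<in>{1..n}. \<Sum>i'\<in>{1..n} - {i}.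
        expectation (\<lambda>\<omega>. W X Y i j \<omega> * W X Y i' j \<omega> * f (X k \<omega>)))"
    unfolding naive_estimator_def mult.assoc sum_distrib_right
    by (subst integral_mult_right_zero, subst integral_triple_sum)
      (use int in \<open>auto simp: mult.assoc\<close>)
  also have "\<dots> = 1 / (real n * (real n - 1)) *
      (\<Sum>j\<in>UNIV. \<Sum>i\<in>{1..n}. \<Sum>i'\<in>{1..n} - {i}. if k = i \<or> k = i' then \<beta> $ j * ?c j else 0)"
    using expectation_W_mult_W_mult_polynomial[OF _ _ _ k f mean_f]
    by (intro arg_cong2[of _ _ _ _ "(*)"] sum.cong refl) auto
  also have "\<dots> = 1 / (real n * (real n - 1)) * (\<Sum>j\<in>UNIV. 2 * (real n - 1) * (\<beta> $ j * ?c j))"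
    using sum_pairs_containing[OF k] by simp
  also have "\<dots> = 2 / real n * (\<Sum>j\<in>UNIV. \<beta> $ j * ?c j)"
    using sample_size by (simp add: sum_distrib_left[symmetric] divide_simps)
  also have "(\<Sum>j\<in>UNIV. \<beta> $ j * ?c j) = (\<integral>x. (\<Sum>j\<in>UNIV. \<beta> $ j * (x $ j * f x * (\<beta> \<bullet> x))) \<partial>D)"
  proof -
    have "real_polynomial_function (\<lambda>x. x $ j * f x * (\<beta> \<bullet> x))" for j
      by (intro real_polynomial_function_intros f)
    from integrable_D_polynomial[OF this] show ?thesis by simp
  qed
  \<comment> \<open>One factor \<open>\<beta> \<bullet> x\<close> came from the response of
    observation \<open>k\<close>; the second is reassembled from the coordinates weighted by
    \<open>\<beta> $ j\<close>.\<close>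
  also have "\<dots> = (\<integral>x. (\<beta> \<bullet> x)\<^sup>2 * f x \<partial>D)"
  proof -
    have "(\<Sum>j\<in>UNIV. \<beta> $ j * (x $ j * f x * (\<beta> \<bullet> x))) = (\<beta> \<bullet> x) * (f x * (\<beta> \<bullet> x))" for x
      by (subst (2) inner_vec_def) (simp add: sum_distrib_right mult.assoc)
    then show ?thesis by (simp add: power2_eq_square mult_ac)
  qed
  finally show ?thesis .
qed

section \<open>Averages of centred polynomials and orthogonality\<close>

text \<open>For distinct observations the expectation factorises, and the factor of the centred
  \<open>f\<close> is zero.\<close>

lemma expectation_polynomial_mult_polynomial:
  assumes "i \<in> {1..n}" "k \<in> {1..n}" and q: "real_polynomial_function q"
    and f: "real_polynomial_function f" and mean_f: "(\<integral>x. f x \<partial>D) = 0"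
  shows "expectation (\<lambda>\<omega>. q (X i \<omega>) * f (X k \<omega>)) = (if i = k then \<integral>x. q x * f x \<partial>D else 0)"
proof (cases "i = k")
  case True
  have "real_polynomial_function (\<lambda>x. q x * f x)" by (intro real_polynomial_function_intros q f)
  with True show ?thesis using expectation_polynomial[OF assms(1)] by simp
next
  case False
  let ?\<phi> = "\<lambda>l z. if l = k then f (fst z) else q (fst z)"
  have meas: "(\<lambda>z. p (fst z)) \<in> borel_measurable (borel :: ((real ^ 'p) \<times> real) measure)"
    if "real_polynomial_function p" for p
    by (rule measurable_compose[OF _ real_polynomial_function_measurable[OF that]])
      (intro borel_measurable_continuous_onI continuous_intros)
  have "expectation (\<lambda>\<omega>. \<Prod>l\<in>{i, k}. ?\<phi> l (X l \<omega>, Y l \<omega>))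
      = (\<Prod>l\<in>{i, k}. expectation (\<lambda>\<omega>. ?\<phi> l (X l \<omega>, Y l \<omega>)))"
    using assms False meas[OF f] meas[OF q] integrable_polynomial
    by (intro expectation_prod_sample) auto
  then show ?thesis
    using False mean_f expectation_polynomial[OF assms(2) f] by simp
qed

lemma square_integrable_zero_average:
  assumes "real_polynomial_function f"
  shows "square_integrable M (zero_average n D X f)"
proof -
  have "real_polynomial_function (\<lambda>x. f x - (\<integral>x. f x \<partial>D))"
    by (intro real_polynomial_function_intros assms)
  from square_integrable_polynomial[OF _ this] show ?thesis
    unfolding zero_average_def[abs_def] by (intro square_integrable_cmult square_integrable_sum) auto
qed

lemma expectation_zero_average:
  assumes "real_polynomial_function f"
  shows "expectation (zero_average n D X f) = 0"
  using integrable_polynomial[OF _ assms] expectation_polynomial[OF _ assms]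
  by (simp add: zero_average_def[abs_def] prob_space)

lemma oracle_orthogonal:
  assumes f: "real_polynomial_function f"
  shows "expectation (\<lambda>\<omega>. (naive_estimator n X Y \<omega> + zero_average n D X (\<lambda>x. - 2 * (\<beta> \<bullet> x)\<^sup>2) \<omega>)
    * zero_average n D X f \<omega>) = 0"
proof -
  let ?q = "\<lambda>x. - 2 * (\<beta> \<bullet> x)\<^sup>2" and ?f = "\<lambda>x. f x - (\<integral>x. f x \<partial>D)"
  let ?qc = "\<lambda>x. ?q x - (\<integral>x. ?q x \<partial>D)"
  interpret D: prob_space D by (rule prob_space_D)
  have q: "real_polynomial_function ?q" and qc: "real_polynomial_function ?qc"
    and fc: "real_polynomial_function ?f"
    by (intro real_polynomial_function_intros f)+
  have mean_f: "(\<integral>x. ?f x \<partial>D) = 0"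
    using integrable_D_polynomial[OF f] by (simp add: D.prob_space)
  \<comment> \<open>Against the centred \<open>?f\<close> the constant subtracted in
    \<open>?qc\<close> integrates to zero.\<close>
  have qcf: "(\<integral>x. ?qc x * ?f x \<partial>D) = - 2 * (\<integral>x. (\<beta> \<bullet> x)\<^sup>2 * ?f x \<partial>D)"
  proof -
    have "real_polynomial_function (\<lambda>x. ?q x * ?f x)"
      using q fc by (rule real_polynomial_function.intros(4))
    then have "(\<integral>x. ?q x * ?f x - (\<integral>x. ?q x \<partial>D) * ?f x \<partial>D)
        = (\<integral>x. ?q x * ?f x \<partial>D) - (\<integral>x. (\<integral>x. ?q x \<partial>D) * ?f x \<partial>D)"
      by (intro Bochner_Integration.integral_diff integrable_mult_right integrable_D_polynomial fc)
    then show ?thesis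
      by (simp only: left_diff_distrib[of "?q _"] mult.assoc integral_mult_right_zero mean_f)
  qed
  have qk: "expectation (\<lambda>\<omega>. zero_average n D X ?q \<omega> * ?f (X k \<omega>))
      = - 2 / real n * (\<integral>x. (\<beta> \<bullet> x)\<^sup>2 * ?f x \<partial>D)" if k: "k \<in> {1..n}" for k
  proof -
    have int: "integrable M (\<lambda>\<omega>. ?qc (X i \<omega>) * ?f (X k \<omega>))" if "i \<in> {1..n}" for i
      by (rule square_integrable_mult[OF square_integrable_polynomial[OF that qc]
            square_integrable_polynomial[OF k fc]])
    have "expectation (\<lambda>\<omega>. zero_average n D X ?q \<omega> * ?f (X k \<omega>))
        = 1 / real n * (\<Sum>i\<in>{1..n}. expectation (\<lambda>\<omega>. ?qc (X i \<omega>) * ?f (X k \<omega>)))"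
      unfolding zero_average_def mult.assoc sum_distrib_right
      by (subst integral_mult_right_zero, subst Bochner_Integration.integral_sum[OF int]) auto
    also have "\<dots> = 1 / real n * (\<Sum>i\<in>{1..n}. if i = k then \<integral>x. ?qc x * ?f x \<partial>D else 0)"
      using expectation_polynomial_mult_polynomial[OF _ k qc fc mean_f]
      by (intro arg_cong2[of _ _ _ _ "(*)"] sum.cong refl) auto
    also have "\<dots> = 1 / real n * (\<integral>x. ?qc x * ?f x \<partial>D)"
      using k by simp
    finally show ?thesis unfolding qcf by simp
  qed
  let ?R = "\<lambda>\<omega>. naive_estimator n X Y \<omega> + zero_average n D X ?q \<omega>"
  \<comment> \<open>The contributions \<open>2 / n\<close> of the naive estimator and
    \<open>- 2 / n\<close> of the correction cancel for each observation \<open>k\<close>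
    separately.\<close>
  have R: "expectation (\<lambda>\<omega>. ?R \<omega> * ?f (X k \<omega>)) = 0" if k: "k \<in> {1..n}" for k
    using qk[OF k] expectation_naive_estimator_mult_polynomial[OF k fc mean_f]
      square_integrable_mult[OF square_integrable_naive_estimator square_integrable_polynomial[OF k fc]]
      square_integrable_mult[OF square_integrable_zero_average[OF q] square_integrable_polynomial[OF k fc]]
    by (simp add: distrib_right)
  have int: "integrable M (\<lambda>\<omega>. ?R \<omega> * ?f (X k \<omega>))" if "k \<in> {1..n}" for k
    by (intro square_integrable_mult square_integrable_add square_integrable_naive_estimator
        square_integrable_zero_average[OF q] square_integrable_polynomial[OF that fc])
  have "expectation (\<lambda>\<omega>. ?R \<omega> * zero_average n D X f \<omega>)
      = expectation (\<lambda>\<omega>. 1 / real n * (\<Sum>k\<in>{1..n}. ?R \<omega> * ?f (X k \<omega>)))"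
    unfolding zero_average_def[of _ _ _ f] by (simp only: sum_distrib_left sum_distrib_right mult_ac)
  also have "\<dots> = 1 / real n * (\<Sum>k\<in>{1..n}. expectation (\<lambda>\<omega>. ?R \<omega> * ?f (X k \<omega>)))"
    by (subst integral_mult_right_zero, subst Bochner_Integration.integral_sum[OF int]) auto
  also have "\<dots> = 0" using R by simp
  finally show ?thesis .
qed

section \<open>Zero-estimators as averages of centred polynomials\<close>

lemma zero_average_linear_combination:
  assumes "\<And>k. k \<in> K \<Longrightarrow> real_polynomial_function (f k)"
  shows "zero_average n D X (\<lambda>x. \<Sum>k\<in>K. c k * f k x) \<omega> = (\<Sum>k\<in>K. c k * zero_average n D X (f k) \<omega>)"
proof -
  have "(\<integral>x. (\<Sum>k\<in>K. c k * f k x) \<partial>D) = (\<Sum>k\<in>K. c k * (\<integral>x. f k x \<partial>D))"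
    using integrable_D_polynomial[OF assms] by simp
  then have "zero_average n D X (\<lambda>x. \<Sum>k\<in>K. c k * f k x) \<omega>
      = 1 / real n * (\<Sum>i\<in>{1..n}. \<Sum>k\<in>K. c k * (f k (X i \<omega>) - (\<integral>x. f k x \<partial>D)))"
    by (simp add: zero_average_def sum_subtractf right_diff_distrib)
  also have "\<dots> = (\<Sum>k\<in>K. c k * zero_average n D X (f k) \<omega>)"
    by (subst sum.swap) (simp add: zero_average_def sum_distrib_left mult_ac)
  finally show ?thesis .
qed

lemma zero_average_diff:
  assumes "real_polynomial_function f" "real_polynomial_function g"
  shows "zero_average n D X (\<lambda>x. f x - g x) \<omega> = zero_average n D X f \<omega> - zero_average n D X g \<omega>"
  \<comment> \<open>A difference is the linear combination over the two-element index type
    \<open>bool\<close> with coefficients \<open>1\<close> and \<open>- 1\<close>.\<close>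
  using zero_average_linear_combination[of "UNIV :: bool set" "\<lambda>b. if b then f else g" "\<lambda>b. if b then 1 else - 1" \<omega>]
    assms by (simp add: UNIV_bool)

text \<open>The same combination of monomials serves as \<open>f\<close>; exponents and coefficients
  can then be forgotten.\<close>

lemma zero_estimators_cases:
  assumes "g \<in> zero_estimators n D X"
  obtains f where "real_polynomial_function f" "g = zero_average n D X f"
proof -
  from assms obtain K c where K: "finite K"
    and g: "g = (\<lambda>\<omega>. \<Sum>k\<in>K. c k * monomial_zero_estimator n D X k \<omega>)"
    by (auto simp: zero_estimators_def)
  have mono: "real_polynomial_function (\<lambda>x :: real ^ 'p. \<Prod>j\<in>UNIV. x $ j ^ k j)" for k
    by (intro real_polynomial_function_prod real_polynomial_function_intros finite)
  show thesis
  proof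
    show "real_polynomial_function (\<lambda>x :: real ^ 'p. \<Sum>k\<in>K. c k * (\<Prod>j\<in>UNIV. x $ j ^ k j))"
      by (intro real_polynomial_function_sum real_polynomial_function_intros mono K)
    show "g = zero_average n D X (\<lambda>x. \<Sum>k\<in>K. c k * (\<Prod>j\<in>UNIV. x $ j ^ k j))"
      by (rule ext, subst zero_average_linear_combination[OF mono])
        (simp add: g monomial_zero_estimator_def zero_average_def)
  qed
qed

text \<open>Expanding the quadratic form over pairs and averaging each term gives
  \<open>\<beta> $ j * \<beta> $ j' * h\<close>, which is \<open>psi\<close>.\<close>

lemma oracle_estimator_eq:
  "oracle_estimator n D X Y \<beta>
    = (\<lambda>\<omega>. naive_estimator n X Y \<omega> + zero_average n D X (\<lambda>x. - 2 * (\<beta> \<bullet> x)\<^sup>2) \<omega>)"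
proof
  fix \<omega>
  have poly: "real_polynomial_function (\<lambda>x :: real ^ 'p. x $ fst p * x $ snd p)" for p
    by (intro real_polynomial_function_intros)
  have "zero_average n D X (\<lambda>x. - 2 * (\<beta> \<bullet> x)\<^sup>2) \<omega>
      = zero_average n D X (\<lambda>x. \<Sum>p\<in>UNIV. - 2 * \<beta> $ fst p * \<beta> $ snd p * (x $ fst p * x $ snd p)) \<omega>"
    by (simp add: inner_power2_expand sum_distrib_left case_prod_unfold mult.assoc sum_negf)
  also have "\<dots> = (\<Sum>p\<in>UNIV. - 2 * \<beta> $ fst p * \<beta> $ snd p * h n D X (fst p) (snd p) \<omega>)"
    by (subst zero_average_linear_combination[OF poly]) (simp add: zero_average_def h_def)
  also have "\<dots> = - 2 * (\<Sum>j\<in>UNIV. \<Sum>j'\<in>UNIV. psi n D X \<beta> j j' \<omega>)"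
    by (simp add: psi_def sum.cartesian_product case_prod_unfold sum_distrib_left mult.assoc sum_negf)
  finally show "oracle_estimator n D X Y \<beta> \<omega>
      = naive_estimator n X Y \<omega> + zero_average n D X (\<lambda>x. - 2 * (\<beta> \<bullet> x)\<^sup>2) \<omega>"
    by (simp add: oracle_estimator_def)
qed

text \<open>The pairs \<open>(j, j')\<close> and \<open>(j', j)\<close> give the same exponents,
  whereas \<open>zero_estimators\<close> sums over a set of exponent functions. Coefficients are
  therefore collected over all pairs with equal exponents.\<close>

lemma oracle_correction_in_zero_estimators:
  "zero_average n D X (\<lambda>x. - 2 * (b \<bullet> x)\<^sup>2) \<in> zero_estimators n D X"
proof -
  let ?a = "\<lambda>p. - 2 * b $ fst p * b $ snd p"
  \<comment> \<open>Exponents of the product of the two coordinates of \<open>p\<close>: one at each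
    of them, two if they coincide. The order of the summands matches two uses of
    \<open>monomial_mult_coordinate\<close> starting from exponent zero.\<close>
  let ?k = "\<lambda>(p :: 'p \<times> 'p) l. (if l = snd p then 1 else 0) + (if l = fst p then 1 else 0) :: nat"
  let ?g = "monomial_zero_estimator n D X"
  have mono: "(\<Prod>l\<in>UNIV. x $ l ^ ?k p l) = x $ fst p * x $ snd p" for x :: "real ^ 'p" and p
    using monomial_mult_coordinate[of x "snd p" "\<lambda>_. 0"]
      monomial_mult_coordinate[of x "fst p" "\<lambda>l. if l = snd p then 1 else 0"]
    by simp
  have poly: "real_polynomial_function (\<lambda>x :: real ^ 'p. x $ fst p * x $ snd p)" for p
    by (intro real_polynomial_function_intros)
  have "zero_average n D X (\<lambda>x. - 2 * (b \<bullet> x)\<^sup>2) \<omega>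
      = (\<Sum>k\<in>range ?k. (\<Sum>p\<in>{p \<in> UNIV. ?k p = k}. ?a p) * ?g k \<omega>)" for \<omega>
  proof -
    have "zero_average n D X (\<lambda>x. - 2 * (b \<bullet> x)\<^sup>2) \<omega>
        = zero_average n D X (\<lambda>x. \<Sum>p\<in>UNIV. ?a p * (x $ fst p * x $ snd p)) \<omega>"
      by (simp add: inner_power2_expand sum_distrib_left case_prod_unfold mult.assoc sum_negf)
    also have "\<dots> = (\<Sum>p\<in>UNIV. ?a p * ?g (?k p) \<omega>)"
      by (subst zero_average_linear_combination[OF poly])
        (simp only: zero_average_def monomial_zero_estimator_def mono)
    also have "\<dots> = (\<Sum>k\<in>range ?k. \<Sum>p\<in>{p \<in> UNIV. ?k p = k}. ?a p * ?g (?k p) \<omega>)"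
      by (rule sum.image_gen) simp
    also have "\<dots> = (\<Sum>k\<in>range ?k. (\<Sum>p\<in>{p \<in> UNIV. ?k p = k}. ?a p) * ?g k \<omega>)"
      unfolding sum_distrib_right by (intro sum.cong refl) auto
    finally show ?thesis .
  qed
  then have "zero_average n D X (\<lambda>x. - 2 * (b \<bullet> x)\<^sup>2)
      = (\<lambda>\<omega>. \<Sum>k\<in>range ?k. (\<Sum>p\<in>{p \<in> UNIV. ?k p = k}. ?a p) * ?g k \<omega>)"
    by (rule ext)
  moreover have "finite (range ?k)" by simp
  ultimately show ?thesis
    unfolding zero_estimators_def
    by (intro CollectI exI[of _ "range ?k"] exI[of _ "\<lambda>k. \<Sum>p\<in>{p \<in> UNIV. ?k p = k}. ?a p"] conjI)
qed

section \<open>Optimality, first at one parameter value and then at all of them\<close>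

lemma variance_oracle_estimator_le:
  assumes "g \<in> zero_estimators n D X"
  shows "variance (oracle_estimator n D X Y \<beta>) \<le> variance (\<lambda>\<omega>. naive_estimator n X Y \<omega> + g \<omega>)"
proof -
  obtain f where f: "real_polynomial_function f" and g: "g = zero_average n D X f"
    using zero_estimators_cases[OF assms] .
  let ?q = "\<lambda>x. - 2 * (\<beta> \<bullet> x)\<^sup>2"
  let ?R = "\<lambda>\<omega>. naive_estimator n X Y \<omega> + zero_average n D X ?q \<omega>"
  have q: "real_polynomial_function ?q" by (intro real_polynomial_function_intros)
  \<comment> \<open>The polynomial \<open>f - ?q\<close> is chosen so that adding its average to
    \<open>?R\<close> removes the correction and inserts \<open>g\<close>.\<close>
  have d: "real_polynomial_function (\<lambda>x. f x - ?q x)" using f q by (rule real_polynomial_function_diff)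
  have "variance ?R \<le> variance (\<lambda>\<omega>. ?R \<omega> + zero_average n D X (\<lambda>x. f x - ?q x) \<omega>)"
    by (intro variance_le_orthogonal square_integrable_add square_integrable_naive_estimator
        square_integrable_zero_average q d expectation_zero_average oracle_orthogonal)
  then show ?thesis
    unfolding oracle_estimator_eq g zero_average_diff[OF f q] by simp
qed

lemma square_integrable_naive_plus_zero_estimator:
  assumes "g \<in> zero_estimators n D X"
  shows "square_integrable M (\<lambda>\<omega>. naive_estimator n X Y \<omega> + g \<omega>)"
proof -
  obtain f where "real_polynomial_function f" "g = zero_average n D X f"
    using zero_estimators_cases[OF assms] .
  then show ?thesis
    by (simp add: square_integrable_add square_integrable_naive_estimator square_integrable_zero_average)
qed

end

theorem theorem2:
  fixes \<Theta> :: "'t set"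
    and M :: "'t \<Rightarrow> 'a measure"
    and n :: nat
    and D :: "(real ^ 'p) measure"
    and X :: "nat \<Rightarrow> 'a \<Rightarrow> real ^ 'p"
    and Y :: "nat \<Rightarrow> 'a \<Rightarrow> real"
    and \<beta> :: "'t \<Rightarrow> real ^ 'p"
    and \<sigma> :: "'t \<Rightarrow> real"
  assumes "\<And>\<theta>. \<theta> \<in> \<Theta> \<Longrightarrow> linear_model (M \<theta>) n D X Y (\<beta> \<theta>) (\<sigma> \<theta>)"
  shows "optimal_oracle_estimator \<Theta> M (\<lambda>\<theta>. (norm (\<beta> \<theta>))\<^sup>2)
           (naive_estimator n X Y) (zero_estimators n D X)
           (\<lambda>\<theta>. oracle_estimator n D X Y (\<beta> \<theta>))"
  unfolding optimal_oracle_estimator_def unbiased_estimator_def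
proof (intro conjI ballI)
  fix \<theta> assume "\<theta> \<in> \<Theta>"
  then interpret linear_model "M \<theta>" n D X Y "\<beta> \<theta>" "\<sigma> \<theta>" by (rule assms)
  show "integrable (M \<theta>) (naive_estimator n X Y)"
    by (rule square_integrable_integrable[OF square_integrable_naive_estimator])
  show "expectation (naive_estimator n X Y) = (norm (\<beta> \<theta>))\<^sup>2"
    by (rule expectation_naive_estimator)
  show "\<exists>g\<in>zero_estimators n D X. oracle_estimator n D X Y (\<beta> \<theta>) = (\<lambda>\<omega>. naive_estimator n X Y \<omega> + g \<omega>)"
    using oracle_estimator_eq oracle_correction_in_zero_estimators by blast
next
  fix \<theta> g assume "\<theta> \<in> \<Theta>" and g: "g \<in> zero_estimators n D X"
  then interpret linear_model "M \<theta>" n D X Y "\<beta> \<theta>" "\<sigma> \<theta>" by (intro assms)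
  note sq = square_integrable_naive_plus_zero_estimator[OF g]
  show "integrable (M \<theta>) (\<lambda>\<omega>. naive_estimator n X Y \<omega> + g \<omega>)"
    by (rule square_integrable_integrable[OF sq])
  show "integrable (M \<theta>) (\<lambda>\<omega>. (naive_estimator n X Y \<omega> + g \<omega>)\<^sup>2)"
    using sq by (simp add: square_integrable_def)
  show "variance (oracle_estimator n D X Y (\<beta> \<theta>)) \<le> variance (\<lambda>\<omega>. naive_estimator n X Y \<omega> + g \<omega>)"
    by (rule variance_oracle_estimator_le[OF g])
qed

end
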